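(* Let $\mathbb{D}$ be the Fraïssé limit of the class $\mathcal{D}$ of finite $L$-structures $A$ such that $(\mathrm{dom}(A), R^A)$ is an $I_3$-free oriented graph and $(\mathrm{dom}(A), S^A)$ is a semifinal structure. Then $\overline{\mathcal{D}} = \mathrm{Age}_\omega(\mathbb{D})$ is not group-extensible.
   Context: $L = \{R, S\}$ with $R$ a binary and $S$ a $4$-ary relation symbol. $(V,R)$ is an $I_3$-free oriented graph if $R$ is irreflexive and asymmetric and every $3$-element subset of $V$ contains two vertices $u,v$ with $R(u,v)$. $(V,S)$ is a semifinal structure if every tuple in $S$ consists of four distinct elements and, for each $B \subseteq V$ with $|B|=4$, there is an enumeration $b_0,b_1,b_2,b_3$ of $B$ such that $S \cap B^4 = \{(b_0,b_1,b_2,b_3),(b_2,b_3,b_0,b_1)\}$. The class $\mathcal{D}$ has strong amalgamation, and $\mathbb{D}$ denotes its Fraïssé limit: the countable ultrahomogeneous structure, unique up to isomorphism, whose finite substructures are up to isomorphism exactly the members of $\mathcal{D}$. For a countable ultrahomogeneous structure $M$, $\mathrm{Age}_\omega(M)$ is the class of all structures (finite or infinite) embeddable in $M$. An embedding $f : A \to M$ is group-extensive if there exists an injective group homomorphism $\eta : \mathrm{Aut}(f(A)) \to \mathrm{Aut}(M)$ with $g \subseteq \eta(g)$ (i.e. $\eta(g)$ extends $g$) for all $g \in \mathrm{Aut}(f(A))$. $\mathrm{Age}_\omega(M)$ is group-extensible if each $A \in \mathrm{Age}_\omega(M)$ admits a group-extensive embedding $A \to M$. *)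

theory Defs
  imports "HOL-Algebra.Bij" "HOL-Library.Countable_Set"
begin

section \<open>Structures in the language with a binary symbol \<open>R\<close> and a 4-ary symbol \<open>S\<close>\<close>

record 'a lstruct =
  universe :: "'a set"
  relR :: "('a \<times> 'a) set"
  relS :: "('a \<times> 'a \<times> 'a \<times> 'a) set"

definition is_struct :: "'a lstruct \<Rightarrow> bool" where
  "is_struct A \<longleftrightarrow>
     relR A \<subseteq> universe A \<times> universe A \<and>
     relS A \<subseteq> universe A \<times> universe A \<times> universe A \<times> universe A"

text \<open>Maps between structures are HOL functions of which only the values on the universe of the
  source matter; elements of automorphism groups are in addition normalised to be
  \<^const>\<open>extensional\<close>, so that equality of group elements is equality of maps on the universe.\<close>

definition is_embedding :: "('a \<Rightarrow> 'b) \<Rightarrow> 'a lstruct \<Rightarrow> 'b lstruct \<Rightarrow> bool" where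
  "is_embedding f A B \<longleftrightarrow>
     f ` universe A \<subseteq> universe B \<and> inj_on f (universe A) \<and>
     (\<forall>x\<in>universe A. \<forall>y\<in>universe A. (x, y) \<in> relR A \<longleftrightarrow> (f x, f y) \<in> relR B) \<and>
     (\<forall>x\<in>universe A. \<forall>y\<in>universe A. \<forall>z\<in>universe A. \<forall>w\<in>universe A.
        (x, y, z, w) \<in> relS A \<longleftrightarrow> (f x, f y, f z, f w) \<in> relS B)"

definition is_isomorphism :: "('a \<Rightarrow> 'b) \<Rightarrow> 'a lstruct \<Rightarrow> 'b lstruct \<Rightarrow> bool" where
  "is_isomorphism f A B \<longleftrightarrow> is_embedding f A B \<and> f ` universe A = universe B"

definition isomorphic :: "'a lstruct \<Rightarrow> 'b lstruct \<Rightarrow> bool" where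
  "isomorphic A B \<longleftrightarrow> (\<exists>f. is_isomorphism f A B)"

definition substruct :: "'a lstruct \<Rightarrow> 'a set \<Rightarrow> 'a lstruct" where
  "substruct M X = \<lparr>universe = X, relR = relR M \<inter> (X \<times> X), relS = relS M \<inter> (X \<times> X \<times> X \<times> X)\<rparr>"

definition Aut :: "'a lstruct \<Rightarrow> ('a \<Rightarrow> 'a) monoid" where
  "Aut M = BijGroup (universe M) \<lparr>carrier := {g \<in> Bij (universe M). is_isomorphism g M M}\<rparr>"

lemma is_isomorphism_compose:
  assumes f: "is_isomorphism f M M" and g: "is_isomorphism g M M"
  shows "is_isomorphism (compose (universe M) g f) M M"
proof -
  have fim: "f ` universe M = universe M" and gim: "g ` universe M = universe M"
    using f g by (auto simp: is_isomorphism_def)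
  have fx: "f x \<in> universe M" if "x \<in> universe M" for x
    using fim that by blast
  have "compose (universe M) g f ` universe M = g ` f ` universe M"
    by (auto simp: compose_def)
  then have 1: "compose (universe M) g f ` universe M = universe M"
    by (simp only: fim gim)
  have 2: "inj_on (compose (universe M) g f) (universe M)"
    using f g fx unfolding is_isomorphism_def is_embedding_def inj_on_def
    by (metis compose_eq)
  have 3: "(x, y) \<in> relR M \<longleftrightarrow> (g (f x), g (f y)) \<in> relR M"
    if "x \<in> universe M" "y \<in> universe M" for x y
    using f g fx that unfolding is_isomorphism_def is_embedding_def by metis
  have 4: "(x, y, z, w) \<in> relS M \<longleftrightarrow> (g (f x), g (f y), g (f z), g (f w)) \<in> relS M"
    if "x \<in> universe M" "y \<in> universe M" "z \<in> universe M" "w \<in> universe M" for x y z w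
    using f g fx that unfolding is_isomorphism_def is_embedding_def by metis
  show ?thesis
    unfolding is_isomorphism_def is_embedding_def
    using 1 2 3 4 by (auto simp: compose_eq)
qed

lemma is_isomorphism_inverse:
  assumes g: "is_isomorphism g M M"
  shows "is_isomorphism (restrict (inv_into (universe M) g) (universe M)) M M"
proof -
  let ?h = "inv_into (universe M) g"
  have im: "g ` universe M = universe M" and inj: "inj_on g (universe M)"
    using g by (auto simp: is_isomorphism_def is_embedding_def)
  have h: "?h x \<in> universe M" "g (?h x) = x" if "x \<in> universe M" for x
    using that im by (metis inv_into_into, metis f_inv_into_f)
  have "bij_betw ?h (universe M) (universe M)"
    using im inj by (metis bij_betw_def bij_betw_inv_into)
  then have 1: "?h ` universe M = universe M" "inj_on ?h (universe M)"
    by (auto simp: bij_betw_def)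
  have 2: "(x, y) \<in> relR M \<longleftrightarrow> (?h x, ?h y) \<in> relR M"
    if "x \<in> universe M" "y \<in> universe M" for x y
    using g h that unfolding is_isomorphism_def is_embedding_def by metis
  have 3: "(x, y, z, w) \<in> relS M \<longleftrightarrow> (?h x, ?h y, ?h z, ?h w) \<in> relS M"
    if "x \<in> universe M" "y \<in> universe M" "z \<in> universe M" "w \<in> universe M" for x y z w
    using g h that unfolding is_isomorphism_def is_embedding_def by metis
  show ?thesis
    unfolding is_isomorphism_def is_embedding_def
    using 1 2 3 by (auto simp: inj_on_def h)
qed

lemma group_Aut: "group (Aut M)"
proof -
  have "subgroup {g \<in> Bij (universe M). is_isomorphism g M M} (BijGroup (universe M))"
  proof (rule group.subgroupI[OF group_BijGroup])
    show "{g \<in> Bij (universe M). is_isomorphism g M M} \<subseteq> carrier (BijGroup (universe M))"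
      by (auto simp: BijGroup_def)
    have "is_isomorphism (\<lambda>x\<in>universe M. x) M M"
      by (simp add: is_isomorphism_def is_embedding_def)
    then show "{g \<in> Bij (universe M). is_isomorphism g M M} \<noteq> {}"
      using id_Bij by blast
  next
    fix g assume "g \<in> {g \<in> Bij (universe M). is_isomorphism g M M}"
    then show "inv\<^bsub>BijGroup (universe M)\<^esub> g \<in> {g \<in> Bij (universe M). is_isomorphism g M M}"
      using is_isomorphism_inverse[of g M] restrict_inv_into_Bij[of g "universe M"]
      by (auto simp: inv_BijGroup)
  next
    fix g h
    assume "g \<in> {g \<in> Bij (universe M). is_isomorphism g M M}"
      "h \<in> {g \<in> Bij (universe M). is_isomorphism g M M}"
    then show "g \<otimes>\<^bsub>BijGroup (universe M)\<^esub> h \<in> {g \<in> Bij (universe M). is_isomorphism g M M}"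
      using is_isomorphism_compose[of h M g] by (auto simp: BijGroup_def compose_Bij)
  qed
  then show ?thesis
    unfolding Aut_def by (rule subgroup.subgroup_is_group[OF _ group_BijGroup])
qed

section \<open>Ultrahomogeneity and Fraisse limits\<close>

definition ultrahomogeneous :: "'a lstruct \<Rightarrow> bool" where
  "ultrahomogeneous M \<longleftrightarrow>
     (\<forall>X Y f. finite X \<and> finite Y \<and> X \<subseteq> universe M \<and> Y \<subseteq> universe M \<and>
        is_isomorphism f (substruct M X) (substruct M Y) \<longrightarrow>
        (\<exists>g\<in>carrier (Aut M). \<forall>x\<in>X. g x = f x))"

text \<open>A class of finite structures is represented by its members with universe a set of natural
  numbers, which meet every isomorphism type of finite structures. The limit itself may live on any
  type.\<close>

definition fraisse_limit :: "nat lstruct set \<Rightarrow> 'a lstruct \<Rightarrow> bool" where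
  "fraisse_limit K M \<longleftrightarrow>
     is_struct M \<and> countable (universe M) \<and> ultrahomogeneous M \<and>
     (\<forall>X. finite X \<and> X \<subseteq> universe M \<longrightarrow> (\<exists>B\<in>K. isomorphic (substruct M X) B)) \<and>
     (\<forall>B\<in>K. \<exists>X. finite X \<and> X \<subseteq> universe M \<and> isomorphic (substruct M X) B)"

section \<open>Group-extensibility\<close>

text \<open>Every structure embeddable in \<open>M\<close> is isomorphic to one on the element type of \<open>M\<close>, and
  admitting a group-extensive embedding is invariant under isomorphism, so it suffices to collect
  the structures on that type.\<close>

definition Age_omega :: "'a lstruct \<Rightarrow> 'a lstruct set" where
  "Age_omega M = {A. is_struct A \<and> (\<exists>f. is_embedding f A M)}"

definition group_extensive :: "('a \<Rightarrow> 'b) \<Rightarrow> 'a lstruct \<Rightarrow> 'b lstruct \<Rightarrow> bool" where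
  "group_extensive f A M \<longleftrightarrow>
     is_embedding f A M \<and>
     (\<exists>\<eta>\<in>hom (Aut (substruct M (f ` universe A))) (Aut M).
        inj_on \<eta> (carrier (Aut (substruct M (f ` universe A)))) \<and>
        (\<forall>g\<in>carrier (Aut (substruct M (f ` universe A))). \<forall>x\<in>f ` universe A. \<eta> g x = g x))"

definition group_extensible_Age_omega :: "'a lstruct \<Rightarrow> bool" where
  "group_extensible_Age_omega M \<longleftrightarrow> (\<forall>A\<in>Age_omega M. \<exists>f. group_extensive f A M)"

section \<open>The class of structures\<close>

definition I3_free_oriented_graph :: "'a set \<Rightarrow> ('a \<times> 'a) set \<Rightarrow> bool" where
  "I3_free_oriented_graph V R \<longleftrightarrow>
     R \<subseteq> V \<times> V \<and> irrefl R \<and> asym R \<and>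
     (\<forall>T\<subseteq>V. card T = 3 \<longrightarrow> (\<exists>u\<in>T. \<exists>v\<in>T. (u, v) \<in> R))"

definition semifinal :: "'a set \<Rightarrow> ('a \<times> 'a \<times> 'a \<times> 'a) set \<Rightarrow> bool" where
  "semifinal V S \<longleftrightarrow>
     S \<subseteq> V \<times> V \<times> V \<times> V \<and>
     (\<forall>(a, b, c, d)\<in>S. distinct [a, b, c, d]) \<and>
     (\<forall>B\<subseteq>V. card B = 4 \<longrightarrow>
        (\<exists>b0 b1 b2 b3. distinct [b0, b1, b2, b3] \<and> B = {b0, b1, b2, b3} \<and>
           S \<inter> (B \<times> B \<times> B \<times> B) = {(b0, b1, b2, b3), (b2, b3, b0, b1)}))"

definition class_D :: "nat lstruct set" where
  "class_D = {A. is_struct A \<and> finite (universe A) \<and>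
     I3_free_oriented_graph (universe A) (relR A) \<and> semifinal (universe A) (relS A)}"

end

theory Submission
  imports Defs
begin

text \<open>
  Let \<open>A\<close> be the structure on three points \<open>p, q, r\<close> with edges \<open>p \<rightarrow> q\<close> and \<open>p \<rightarrow> r\<close> only. Swapping
  \<open>q\<close> and \<open>r\<close> is an involution of \<open>A\<close>, so a group-extensive embedding would yield an involution \<open>\<tau>\<close>
  of the limit fixing \<open>p\<close> and swapping \<open>q\<close> and \<open>r\<close>. Choose \<open>c \<noteq> p\<close> not adjacent to \<open>p\<close>. If \<open>\<tau>\<close>
  moved \<open>c\<close>, then \<open>p, c, \<tau> c\<close> would be independent, as an involution cannot swap the ends of an
  oriented edge. Hence \<open>\<tau>\<close> fixes \<open>c\<close> and restricts to a transposition of \<open>{p, c, q, r}\<close>, but a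
  nontrivial automorphism of a four-element semifinal structure has no fixed point.
\<close>

section \<open>Heredity of the two defining conditions, and their transfer to the limit\<close>

lemma I3_free_oriented_graph_pullback:
  assumes e: "is_embedding f A B" and A: "is_struct A"
    and B: "I3_free_oriented_graph (universe B) (relR B)"
  shows "I3_free_oriented_graph (universe A) (relR A)"
proof -
  have im: "f x \<in> universe B" if "x \<in> universe A" for x
    using e that by (auto simp: is_embedding_def)
  have inj: "inj_on f (universe A)"
    using e by (simp add: is_embedding_def)
  have R: "(x, y) \<in> relR A \<longleftrightarrow> (f x, f y) \<in> relR B"
    if "x \<in> universe A" "y \<in> universe A" for x y
    using e that by (simp add: is_embedding_def)
  have sub: "relR A \<subseteq> universe A \<times> universe A"
    using A by (simp add: is_struct_def)
  have irr: "irrefl (relR B)" and asy: "asym (relR B)"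
    and I3: "\<And>T. T \<subseteq> universe B \<Longrightarrow> card T = 3 \<Longrightarrow> \<exists>u\<in>T. \<exists>v\<in>T. (u, v) \<in> relR B"
    using B by (auto simp: I3_free_oriented_graph_def)
  have "irrefl (relR A)"
    using irr sub R by (auto simp: irrefl_def)
  moreover have "asym (relR A)"
  proof (rule asymI)
    fix x y assume xy: "(x, y) \<in> relR A"
    then have "x \<in> universe A" "y \<in> universe A" using sub by auto
    then show "(y, x) \<notin> relR A"
      using xy R asymD[OF asy] by blast
  qed
  moreover have "\<exists>u\<in>T. \<exists>v\<in>T. (u, v) \<in> relR A" if T: "T \<subseteq> universe A" "card T = 3" for T
  proof -
    have "card (f ` T) = 3"
      using T inj by (metis card_image inj_on_subset)
    then have "\<exists>u\<in>f ` T. \<exists>v\<in>f ` T. (u, v) \<in> relR B"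
      using I3[of "f ` T"] T(1) im by blast
    then show ?thesis using R T(1) by blast
  qed
  ultimately show ?thesis
    using sub by (simp add: I3_free_oriented_graph_def)
qed

text \<open>An embedding restricts to a bijection from a four-element set \<open>X\<close> onto
  \<open>f\<close> X\<open>. The enumeration that the axiom provides for\<close>f \<open>X\<close>
  can therefore be pulled back to \<open>X\<close>.\<close>

lemma semifinal_pullback:
  assumes e: "is_embedding f A B" and A: "is_struct A"
    and B: "semifinal (universe B) (relS B)"
  shows "semifinal (universe A) (relS A)"
proof -
  have im: "f x \<in> universe B" if "x \<in> universe A" for x
    using e that by (auto simp: is_embedding_def)
  have inj: "inj_on f (universe A)"
    using e by (simp add: is_embedding_def)
  have S: "(x, y, z, w) \<in> relS A \<longleftrightarrow> (f x, f y, f z, f w) \<in> relS B"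
    if "x \<in> universe A" "y \<in> universe A" "z \<in> universe A" "w \<in> universe A" for x y z w
    using e that by (simp add: is_embedding_def)
  have sub: "relS A \<subseteq> universe A \<times> universe A \<times> universe A \<times> universe A"
    using A by (simp add: is_struct_def)
  have dist: "distinct [x, y, z, w]" if "(x, y, z, w) \<in> relS A" for x y z w
  proof -
    have "(f x, f y, f z, f w) \<in> relS B"
      using that sub S by blast
    then have "distinct [f x, f y, f z, f w]"
      using B by (auto simp: semifinal_def)
    then show ?thesis by auto
  qed
  moreover have "\<exists>b0 b1 b2 b3. distinct [b0, b1, b2, b3] \<and> X = {b0, b1, b2, b3} \<and>
           relS A \<inter> (X \<times> X \<times> X \<times> X) = {(b0, b1, b2, b3), (b2, b3, b0, b1)}"
    if X: "X \<subseteq> universe A" "card X = 4" for X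
  proof -
    have injX: "inj_on f X" using X(1) inj by (rule inj_on_subset[rotated])
    have "card (f ` X) = 4" "f ` X \<subseteq> universe B"
      using X injX im by (auto simp: card_image)
    then obtain c0 c1 c2 c3 where c: "distinct [c0, c1, c2, c3]" "f ` X = {c0, c1, c2, c3}"
      and Sc: "relS B \<inter> (f ` X \<times> f ` X \<times> f ` X \<times> f ` X) = {(c0, c1, c2, c3), (c2, c3, c0, c1)}"
      using B unfolding semifinal_def by meson
    have "c0 \<in> f ` X" "c1 \<in> f ` X" "c2 \<in> f ` X" "c3 \<in> f ` X"
      by (simp_all add: c(2))
    then obtain b0 b1 b2 b3 where b: "b0 \<in> X" "b1 \<in> X" "b2 \<in> X" "b3 \<in> X"
      and fb: "c0 = f b0" "c1 = f b1" "c2 = f b2" "c3 = f b3"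
      by blast
    have "f ` X = f ` {b0, b1, b2, b3}"
      by (simp add: c(2) fb)
    then have Xb: "X = {b0, b1, b2, b3}"
      using inj_on_image_eq_iff[OF injX, of X "{b0, b1, b2, b3}"] b by simp
    have f_eq: "x = y" if "f x = f y" "x \<in> X" "y \<in> X" for x y
      using injX that by (rule inj_onD)
    have SX: "(x, y, z, w) \<in> relS A \<longleftrightarrow>
        (x, y, z, w) = (b0, b1, b2, b3) \<or> (x, y, z, w) = (b2, b3, b0, b1)"
      if xs: "x \<in> X" "y \<in> X" "z \<in> X" "w \<in> X" for x y z w
    proof -
      have "(x, y, z, w) \<in> relS A \<longleftrightarrow>
          (f x, f y, f z, f w) \<in> relS B \<inter> (f ` X \<times> f ` X \<times> f ` X \<times> f ` X)"
        using S xs X(1) by blast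
      then show ?thesis
        unfolding Sc fb using xs b f_eq by auto
    qed
    have "relS A \<inter> (X \<times> X \<times> X \<times> X) = {(b0, b1, b2, b3), (b2, b3, b0, b1)}"
    proof (intro equalityI subsetI)
      fix v assume v: "v \<in> relS A \<inter> (X \<times> X \<times> X \<times> X)"
      then obtain x y z w where "v = (x, y, z, w)" "x \<in> X" "y \<in> X" "z \<in> X" "w \<in> X"
        by blast
      then show "v \<in> {(b0, b1, b2, b3), (b2, b3, b0, b1)}"
        using v SX[of x y z w] by blast
    next
      fix v assume "v \<in> {(b0, b1, b2, b3), (b2, b3, b0, b1)}"
      then show "v \<in> relS A \<inter> (X \<times> X \<times> X \<times> X)"
        using b SX[OF b] SX[OF b(3,4,1,2)] by blast
    qed
    moreover have "distinct [b0, b1, b2, b3]"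
      using c(1) by (auto simp: fb)
    ultimately show ?thesis using Xb by blast
  qed
  ultimately show ?thesis
    using sub unfolding semifinal_def by blast
qed

lemma is_struct_substruct: "is_struct (substruct M X)"
  by (auto simp: is_struct_def substruct_def)

lemma is_embedding_substruct: "X \<subseteq> universe M \<Longrightarrow> is_embedding (\<lambda>x. x) (substruct M X) M"
  by (auto simp: is_embedding_def substruct_def)

text \<open>Each axiom speaks of at most four points at a time. It can thus be checked in finite
  substructures of \<open>M\<close>, which are isomorphic to members of \<open>class_D\<close> and
  inherit the axioms by pullback.\<close>

lemma fraisse_limit_class_D_properties:
  assumes M: "fraisse_limit class_D M"
  shows "I3_free_oriented_graph (universe M) (relR M)" "semifinal (universe M) (relS M)"
proof -
  have str: "relR M \<subseteq> universe M \<times> universe M"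
      "relS M \<subseteq> universe M \<times> universe M \<times> universe M \<times> universe M"
    using M by (auto simp: fraisse_limit_def is_struct_def)
  have fin: "I3_free_oriented_graph X (relR M \<inter> (X \<times> X)) \<and>
      semifinal X (relS M \<inter> (X \<times> X \<times> X \<times> X))"
    if X: "finite X" "X \<subseteq> universe M" for X
  proof -
    obtain B h where "B \<in> class_D" "is_isomorphism h (substruct M X) B"
      using M X unfolding fraisse_limit_def isomorphic_def by blast
    then show ?thesis
      using I3_free_oriented_graph_pullback[of h "substruct M X" B]
        semifinal_pullback[of h "substruct M X" B] is_struct_substruct
      by (auto simp: class_D_def is_isomorphism_def substruct_def)
  qed
  show "I3_free_oriented_graph (universe M) (relR M)"
    unfolding I3_free_oriented_graph_def
  proof (intro conjI allI impI)
    show "relR M \<subseteq> universe M \<times> universe M" by (fact str)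
    have no_opp: "(y, x) \<notin> relR M" if xy: "(x, y) \<in> relR M" for x y
    proof -
      have "asym (relR M \<inter> ({x, y} \<times> {x, y}))"
        using fin[of "{x, y}"] xy str by (auto simp: I3_free_oriented_graph_def)
      then show ?thesis using xy by (auto dest: asymD)
    qed
    show "asym (relR M)" using no_opp by (rule asymI)
    \<comment> \<open>A loop is an edge equal to its own reverse, which is the case
      \<open>y = x\<close> of \<open>no_opp\<close>.\<close>
    show "irrefl (relR M)" using no_opp by (auto simp: irrefl_def)
  next
    fix T assume T: "T \<subseteq> universe M" "card T = 3"
    \<comment> \<open>Infinite sets have \<open>card\<close> 0, so a positive cardinality forces
      finiteness.\<close>
    then have "finite T" using card.infinite by fastforce
    then show "\<exists>u\<in>T. \<exists>v\<in>T. (u, v) \<in> relR M"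
      using fin[of T] T unfolding I3_free_oriented_graph_def by blast
  qed
  show "semifinal (universe M) (relS M)"
    unfolding semifinal_def
  proof (intro conjI allI impI)
    show "relS M \<subseteq> universe M \<times> universe M \<times> universe M \<times> universe M" by (fact str)
    have "distinct [x, y, z, w]" if xs: "(x, y, z, w) \<in> relS M" for x y z w
    proof -
      \<comment> \<open>\<open>X\<close> may have fewer than four elements; only the distinctness
        clause of its substructure is used.\<close>
      define X where "X = {x, y, z, w}"
      have "semifinal X (relS M \<inter> (X \<times> X \<times> X \<times> X))"
        using fin[of X] xs str by (auto simp: X_def)
      then have "\<forall>(a, b, c, d) \<in> relS M \<inter> (X \<times> X \<times> X \<times> X). distinct [a, b, c, d]"
        unfolding semifinal_def by (elim conjE)
      moreover have "(x, y, z, w) \<in> relS M \<inter> (X \<times> X \<times> X \<times> X)"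
        using xs by (simp add: X_def)
      ultimately show ?thesis by blast
    qed
    then show "\<forall>(a, b, c, d)\<in>relS M. distinct [a, b, c, d]" by blast
  next
    fix X assume X: "X \<subseteq> universe M" "card X = 4"
    then have "finite X" using card.infinite by fastforce
    then have "semifinal X (relS M \<inter> (X \<times> X \<times> X \<times> X))"
      using fin X by blast
    then show "\<exists>b0 b1 b2 b3. distinct [b0, b1, b2, b3] \<and> X = {b0, b1, b2, b3} \<and>
           relS M \<inter> (X \<times> X \<times> X \<times> X) = {(b0, b1, b2, b3), (b2, b3, b0, b1)}"
      using X(2) unfolding semifinal_def
      by (elim conjE allE[of _ X]) (simp only: Int_assoc Int_absorb subset_refl simp_thms)
  qed
qed

section \<open>Small members of the class and their copies in the limit\<close>

lemma fraisse_limit_class_D_embeds: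
  assumes M: "fraisse_limit class_D M" and B: "B \<in> class_D"
  obtains f where "is_embedding f B M"
proof -
  obtain X h where X: "X \<subseteq> universe M" and h: "is_isomorphism h (substruct M X) B"
    using M B unfolding fraisse_limit_def isomorphic_def by blast
  \<comment> \<open>The limit supplies an isomorphism from a substructure of \<open>M\<close> onto
    \<open>B\<close>; its inverse is the embedding sought.\<close>
  let ?k = "inv_into X h"
  have hX: "h ` X = universe B" and inj: "inj_on h X"
    using h by (auto simp: is_isomorphism_def is_embedding_def substruct_def)
  have k: "?k x \<in> X" "h (?k x) = x" if "x \<in> universe B" for x
    using that hX by (auto simp: inv_into_into f_inv_into_f)
  have R: "(x, y) \<in> relR M \<longleftrightarrow> (h x, h y) \<in> relR B" if "x \<in> X" "y \<in> X" for x y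
    using h that by (auto simp: is_isomorphism_def is_embedding_def substruct_def)
  have S: "(x, y, z, w) \<in> relS M \<longleftrightarrow> (h x, h y, h z, h w) \<in> relS B"
    if "x \<in> X" "y \<in> X" "z \<in> X" "w \<in> X" for x y z w
    using h that by (auto simp: is_isomorphism_def is_embedding_def substruct_def)
  have "is_embedding ?k B M"
    unfolding is_embedding_def
    using X k R S inj_on_inv_into[of "universe B" h X] hX by auto
  then show ?thesis by (rule that)
qed

text \<open>With at most three points there is no four-element subset, so the empty
  \<open>relS\<close> is semifinal.\<close>

lemma small_in_class_D:
  assumes "finite V" "card V \<le> 3" "I3_free_oriented_graph V R"
  shows "\<lparr>universe = V, relR = R, relS = {}\<rparr> \<in> class_D"
proof -
  have "card B \<noteq> 4" if "B \<subseteq> V" for B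
    using card_mono[OF assms(1) that] assms(2) by linarith
  then show ?thesis
    using assms by (auto simp: class_D_def is_struct_def semifinal_def I3_free_oriented_graph_def)
qed

text \<open>This is the structure whose swap of 1 and 2 cannot be extended to an involution of the
  limit.\<close>

lemma fork_in_class_D:
  "\<lparr>universe = {0, 1, 2}, relR = {(0, 1), (0, 2)}, relS = {}\<rparr> \<in> class_D"
proof (rule small_in_class_D)
  have "T = {0, 1, 2}" if "T \<subseteq> {0, 1, 2::nat}" "card T = 3" for T
    using that by (intro card_subset_eq) auto
  then show "I3_free_oriented_graph {0, 1, 2::nat} {(0, 1), (0, 2)}"
    by (auto simp: I3_free_oriented_graph_def irrefl_def intro!: asymI)
qed auto

lemma nonedge_in_class_D:
  "\<lparr>universe = {0, 1}, relR = {}, relS = {}\<rparr> \<in> class_D"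
proof (rule small_in_class_D)
  have "card T \<noteq> 3" if "T \<subseteq> {0, 1::nat}" for T
    using card_mono[OF _ that] by auto
  then show "I3_free_oriented_graph {0, 1::nat} {}"
    by (auto simp: I3_free_oriented_graph_def irrefl_def intro!: asymI)
qed auto

text \<open>Some nonadjacent pair \<open>u\<close>, \<open>v\<close> occurs in \<open>M\<close>.
  Ultrahomogeneity gives an automorphism carrying \<open>u\<close> to \<open>p\<close>, and the
  image of \<open>v\<close> is the required \<open>c\<close>.\<close>

lemma fraisse_limit_class_D_nonneighbour:
  assumes M: "fraisse_limit class_D M" and p: "p \<in> universe M"
  obtains c where "c \<in> universe M" "c \<noteq> p" "(p, c) \<notin> relR M" "(c, p) \<notin> relR M"
proof -
  obtain k where k: "is_embedding k \<lparr>universe = {0, 1::nat}, relR = {}, relS = {}\<rparr> M"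
    using fraisse_limit_class_D_embeds[OF M nonedge_in_class_D] .
  define u v where "u = k 0" and "v = k 1"
  have uv: "u \<in> universe M" "v \<in> universe M" "u \<noteq> v" "(u, v) \<notin> relR M" "(v, u) \<notin> relR M"
    using k by (auto simp: is_embedding_def u_def v_def)
  \<comment> \<open>These are the only tuples possible on a single point, so any two one-point
    substructures are isomorphic.\<close>
  have loop: "(x, x) \<notin> relR M" "(x, x, x, x) \<notin> relS M" for x
    using fraisse_limit_class_D_properties[OF M]
    by (auto simp: I3_free_oriented_graph_def irrefl_def semifinal_def)
  then have "is_isomorphism (\<lambda>_. p) (substruct M {u}) (substruct M {p})"
    by (auto simp: is_isomorphism_def is_embedding_def substruct_def)
  moreover have "ultrahomogeneous M"
    using M by (simp add: fraisse_limit_def)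
  ultimately obtain g where g: "g \<in> carrier (Aut M)" "g u = p"
    unfolding ultrahomogeneous_def using uv(1) p
    by (metis empty_subsetI finite.emptyI finite.insertI insertI1 insert_subset)
  then have "is_embedding g M M"
    by (simp add: Aut_def is_isomorphism_def)
  then have "g v \<in> universe M" "g v \<noteq> g u" "(g u, g v) \<notin> relR M" "(g v, g u) \<notin> relR M"
    using uv by (auto simp: is_embedding_def dest: inj_onD)
  then show ?thesis using g(2) that by simp
qed

section \<open>Involutions of the limit with a fixed point\<close>

text \<open>Only two tuples on the four points lie in \<open>S\<close>, and \<open>t\<close> must
  map the first to itself or to the second. This makes \<open>t\<close> on these points either the
  identity or free of fixed points.\<close>

lemma semifinal_no_transposition:
  assumes S: "semifinal V S" and V: "{x, y, q, r} \<subseteq> V" and d: "distinct [x, y, q, r]"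
    and pres: "\<And>a b c d. a \<in> V \<Longrightarrow> b \<in> V \<Longrightarrow> c \<in> V \<Longrightarrow> d \<in> V \<Longrightarrow>
      (a, b, c, d) \<in> S \<Longrightarrow> (t a, t b, t c, t d) \<in> S"
    and t: "t x = x" "t y = y" "t q = r" "t r = q"
  shows False
proof -
  let ?B = "{x, y, q, r}"
  have "card ?B = 4" using d by simp
  then obtain b0 b1 b2 b3 where b: "distinct [b0, b1, b2, b3]" "?B = {b0, b1, b2, b3}"
    and SB: "S \<inter> (?B \<times> ?B \<times> ?B \<times> ?B) = {(b0, b1, b2, b3), (b2, b3, b0, b1)}"
    using S V unfolding semifinal_def by meson
  have bB: "b0 \<in> ?B" "b1 \<in> ?B" "b2 \<in> ?B" "b3 \<in> ?B"
    by (simp_all add: b(2))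
  have tB: "t a \<in> ?B" if "a \<in> ?B" for a
    using that t by auto
  have "(b0, b1, b2, b3) \<in> S" using SB by blast
  then have "(t b0, t b1, t b2, t b3) \<in> S"
    using pres bB V by (meson subsetD)
  then have "(t b0, t b1, t b2, t b3) \<in> {(b0, b1, b2, b3), (b2, b3, b0, b1)}"
    unfolding SB[symmetric] using tB bB by blast
  \<comment> \<open>The second tuple exchanges \<open>b0\<close> with \<open>b2\<close> and
    \<open>b1\<close> with \<open>b3\<close>, moving every point.\<close>
  then have "(\<forall>a\<in>?B. t a = a) \<or> (\<forall>a\<in>?B. t a \<noteq> a)"
    unfolding b(2) using b(1) by auto
  then have "t q = q \<or> t x \<noteq> x" by blast
  then show False using t d by simp
qed

lemma no_involution_fixing_point:
  assumes M: "fraisse_limit class_D M" and emb: "is_embedding t M M"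
    and inv: "\<And>x. x \<in> universe M \<Longrightarrow> t (t x) = x"
    and pqr: "{p, q, r} \<subseteq> universe M" "distinct [p, q, r]"
    and t: "t p = p" "t q = r" "t r = q"
  shows False
proof -
  note D = fraisse_limit_class_D_properties[OF M]
  have tR: "(x, y) \<in> relR M \<longleftrightarrow> (t x, t y) \<in> relR M"
    if "x \<in> universe M" "y \<in> universe M" for x y
    using emb that by (simp add: is_embedding_def)
  have tM: "t x \<in> universe M" if "x \<in> universe M" for x
    using emb that by (auto simp: is_embedding_def)
  obtain c where c: "c \<in> universe M" "c \<noteq> p" "(p, c) \<notin> relR M" "(c, p) \<notin> relR M"
    using fraisse_limit_class_D_nonneighbour[OF M, of p] pqr(1) by auto
  have pM: "p \<in> universe M" using pqr by simp
  have irr: "(x, x) \<notin> relR M" and asy: "(x, y) \<in> relR M \<Longrightarrow> (y, x) \<notin> relR M" for x y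
    using D(1) by (auto simp: I3_free_oriented_graph_def irrefl_def dest: asymD)
  have "t c = c"
  proof (rule ccontr)
    assume ne: "t c \<noteq> c"
    \<comment> \<open>If \<open>t c = p\<close>, applying \<open>t\<close> again would give
      \<open>c = p\<close>.\<close>
    have "t c \<noteq> p" using inv[OF c(1)] t(1) c(2) by metis
    then have "card {p, c, t c} = 3" using ne c(2) by simp
    moreover have "{p, c, t c} \<subseteq> universe M" using pM c(1) tM by simp
    ultimately have "\<exists>u\<in>{p, c, t c}. \<exists>v\<in>{p, c, t c}. (u, v) \<in> relR M"
      using D(1) unfolding I3_free_oriented_graph_def by blast
    moreover have "(p, t c) \<notin> relR M" "(t c, p) \<notin> relR M"
      using tR[OF pM c(1)] tR[OF c(1) pM] c t(1) by auto
    \<comment> \<open>Since \<open>t\<close> exchanges \<open>c\<close> and \<open>t c\<close>, it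
      would send an edge between them to the reversed edge, against asymmetry.\<close>
    moreover have "(c, t c) \<notin> relR M" "(t c, c) \<notin> relR M"
      using tR[OF c(1) tM[OF c(1)]] inv[OF c(1)] asy by auto
    ultimately show False using c irr by auto
  qed
  then have "distinct [p, c, q, r]" "{p, c, q, r} \<subseteq> universe M"
    using c pqr t by auto
  then show False
    using semifinal_no_transposition[OF D(2), of p c q r t] t \<open>t c = c\<close> emb
    by (auto simp: is_embedding_def)
qed

section \<open>The swap of the fork and the final contradiction\<close>

lemma fork_swap_in_Aut:
  assumes R: "relR N = {(p, q), (p, r)}" and S: "relS N = {}"
    and N: "universe N = {p, q, r}" and d: "distinct [p, q, r]"
  \<comment> \<open>The restriction makes \<open>s\<close> extensional, as elements of
    \<open>Bij\<close> must be.\<close>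
  defines "s \<equiv> \<lambda>x\<in>{p, q, r}. if x = q then r else if x = r then q else p"
  shows "s \<in> carrier (Aut N)" "s \<otimes>\<^bsub>Aut N\<^esub> s = \<one>\<^bsub>Aut N\<^esub>"
proof -
  have v: "s p = p" "s q = r" "s r = q"
    using d by (auto simp: s_def)
  have inj: "inj_on s {p, q, r}" using v d by auto
  have "s \<in> Bij {p, q, r}"
    using inj v by (auto simp: Bij_def bij_betw_def s_def)
  moreover have "is_isomorphism s N N"
    using inj v d by (auto simp: is_isomorphism_def is_embedding_def N R S)
  ultimately show "s \<in> carrier (Aut N)"
    by (simp add: Aut_def N)
  show "s \<otimes>\<^bsub>Aut N\<^esub> s = \<one>\<^bsub>Aut N\<^esub>"
    using \<open>s \<in> Bij {p, q, r}\<close> v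
    by (auto simp: Aut_def BijGroup_def N compose_def restrict_def fun_eq_iff)
qed

theorem proposition4p1:
  fixes M :: "'a lstruct"
  assumes "fraisse_limit class_D M"
  shows "\<not> group_extensible_Age_omega M"
proof
  assume ext: "group_extensible_Age_omega M"
  note D = fraisse_limit_class_D_properties[OF assms]
  obtain k where k: "is_embedding k
      \<lparr>universe = {0, 1, 2::nat}, relR = {(0, 1), (0, 2)}, relS = {}\<rparr> M"
    using fraisse_limit_class_D_embeds[OF assms fork_in_class_D] .
  \<comment> \<open>\<open>Age_omega M\<close> contains structures on the element type of
    \<open>M\<close>, so the fork over \<open>nat\<close> is replaced by its copy in
    \<open>M\<close>.\<close>
  define A where "A = substruct M {k 0, k 1, k 2}"
  have UA: "universe A = {k 0, k 1, k 2}" by (simp add: A_def substruct_def)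
  have kM: "{k 0, k 1, k 2} \<subseteq> universe M" and kd: "distinct [k 0, k 1, k 2]"
    using k by (auto simp: is_embedding_def)
  have RA: "(k 0, k 1) \<in> relR A" "(k 0, k 2) \<in> relR A"
      "(k 1, k 2) \<notin> relR A" "(k 2, k 1) \<notin> relR A"
    using k by (auto simp: is_embedding_def A_def substruct_def)
  have "A \<in> Age_omega M"
    using is_embedding_substruct[OF kM] is_struct_substruct by (auto simp: Age_omega_def A_def)
  then obtain f where f: "group_extensive f A M"
    using ext by (auto simp: group_extensible_Age_omega_def)
  \<comment> \<open>The image of \<open>f\<close> may be a different copy of the fork. Extensions
    are provided for automorphisms of this image, whose relations are determined next.\<close>
  define p q r where "p = f (k 0)" and "q = f (k 1)" and "r = f (k 2)"
  define N where "N = substruct M {p, q, r}"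
  have fe: "is_embedding f A M" using f by (simp add: group_extensive_def)
  have fU: "f ` universe A = {p, q, r}" by (simp add: UA p_def q_def r_def)
  have pqr: "{p, q, r} \<subseteq> universe M" using fe fU by (auto simp: is_embedding_def)
  have "inj_on f {k 0, k 1, k 2}" using fe by (simp add: is_embedding_def UA)
  then have d: "distinct [p, q, r]"
    using kd by (auto simp: p_def q_def r_def)
  have "(p, q) \<in> relR M" "(p, r) \<in> relR M" "(q, r) \<notin> relR M" "(r, q) \<notin> relR M"
    using fe RA by (simp_all add: is_embedding_def UA p_def q_def r_def)
  moreover from this have "(q, p) \<notin> relR M" "(r, p) \<notin> relR M"
    using D(1) by (auto simp: I3_free_oriented_graph_def dest: asymD)
  moreover have "(x, x) \<notin> relR M" for x
    using D(1) by (auto simp: I3_free_oriented_graph_def irrefl_def)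
  ultimately have RN: "relR N = {(p, q), (p, r)}"
    by (auto simp: N_def substruct_def)
  \<comment> \<open>Tuples of \<open>relS M\<close> have four distinct entries, which three points
    cannot supply.\<close>
  have SN: "relS N = {}"
    using D(2) by (fastforce simp: N_def substruct_def semifinal_def)
  have UN: "universe N = {p, q, r}" by (simp add: N_def substruct_def)
  define s where "s = (\<lambda>x\<in>{p, q, r}. if x = q then r else if x = r then q else p)"
  have s: "s \<in> carrier (Aut N)" "s \<otimes>\<^bsub>Aut N\<^esub> s = \<one>\<^bsub>Aut N\<^esub>"
    using fork_swap_in_Aut[OF RN SN UN d] by (simp_all add: s_def)
  obtain \<eta> where \<eta>: "\<eta> \<in> hom (Aut N) (Aut M)"
      and ex: "\<And>g x. g \<in> carrier (Aut N) \<Longrightarrow> x \<in> {p, q, r} \<Longrightarrow> \<eta> g x = g x"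
    using f unfolding group_extensive_def fU N_def by blast
  define t where "t = \<eta> s"
  have tA: "t \<in> carrier (Aut M)" using \<eta> s(1) by (auto simp: t_def hom_def)
  \<comment> \<open>The homomorphism property is what makes the extension \<open>t\<close> an
    involution on all of \<open>M\<close>, rather than only on \<open>N\<close>.\<close>
  have "t \<otimes>\<^bsub>Aut M\<^esub> t = \<eta> (s \<otimes>\<^bsub>Aut N\<^esub> s)"
    using \<eta> s(1) by (simp add: hom_mult t_def)
  also have "\<dots> = \<one>\<^bsub>Aut M\<^esub>"
    using hom_one[OF \<eta> group_Aut group_Aut] s(2) by simp
  finally have "compose (universe M) t t = (\<lambda>x\<in>universe M. x)"
    using tA by (simp add: Aut_def BijGroup_def)
  then have inv: "t (t x) = x" if "x \<in> universe M" for x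
    using that by (metis compose_eq restrict_apply')
  have "t p = p" "t q = r" "t r = q"
    using ex[OF s(1)] d by (auto simp: t_def s_def)
  moreover have "is_embedding t M M"
    using tA by (simp add: Aut_def is_isomorphism_def)
  ultimately show False
    using no_involution_fixing_point[OF assms _ inv pqr d] by blast
qed

end
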